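(* Let $\sigma$ be a background on $\mathbb{Z}^d$ satisfying (i) $\sigma(x)\ge 2d-2$ for all $x\in\mathbb{Z}^d$; and (ii) there exists $r_0\in\mathbb{N}$ such that for all integers $r\ge r_0$ and all $i=1,\ldots,2d$, the outer face $F_i(Q_r)$ contains a site $x$ with $\sigma(x)\ge 2d-1$. Then $\sigma$ is explosive.
   Context: Abelian sandpile on $\mathbb{Z}^d$: a configuration is a function $\eta:\mathbb{Z}^d\to\mathbb{Z}$; a site $x$ is unstable if $\eta(x)\ge 2d$, and toppling it sends one particle to each of its $2d$ lattice neighbours. $\delta_o$ is a single particle at the origin. Given a background $\sigma$ and $n\ge1$, enumerate the sites of $\mathbb{Z}^d$ and topple, at each discrete time step, the smallest unstable site of $\sigma+n\delta_o$ (if any); $T_n$ is the set of sites that ever topple. $\sigma$ is explosive if $T_n=\mathbb{Z}^d$ for some $n$ (equivalently, for some $n$ every site topples infinitely often). $Q_r=\{x\in\mathbb{Z}^d:\max_i|x_i|\le r\}$. Let $\psi_1=e_1,\ldots,\psi_d=e_d,\psi_{d+1}=-e_1,\ldots,\psi_{2d}=-e_d$ be the coordinate directions; for a rectangular prism $R$, $F_i(R)=\{y: y\notin R,\ y-\psi_i\in R\}$ is the outer face of $R$ in direction $\psi_i$. *)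

theory Defs
  imports "HOL-Analysis.Finite_Cartesian_Product"
begin

text \<open>The lattice \<open>\<int>\<^sup>d\<close> is the type \<open>int ^ 'd\<close> with \<open>d = CARD('d)\<close>.\<close>

type_synonym 'd site = "int ^ 'd"
type_synonym 'd config = "int ^ 'd \<Rightarrow> int"

text \<open>The \<open>2d\<close> coordinate directions \<open>\<psi>\<^sub>1, \<dots>, \<psi>\<^sub>2\<^sub>d\<close>, as a set. Their numbering is irrelevant,
  and the index type \<open>'d\<close> carries no order.\<close>

definition directions :: "('d::finite) site set" where
  "directions = range (\<lambda>k. axis k 1) \<union> range (\<lambda>k. axis k (-1))"

definition unstable :: "('d::finite) config \<Rightarrow> 'd site \<Rightarrow> bool" where
  "unstable \<eta> x \<longleftrightarrow> \<eta> x \<ge> 2 * int CARD('d)"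

definition topple :: "('d::finite) site \<Rightarrow> 'd config \<Rightarrow> 'd config" where
  "topple x \<eta> = (\<lambda>y. \<eta> y - (if y = x then 2 * int CARD('d) else 0)
                          + (if y - x \<in> directions then 1 else 0))"

definition delta_origin :: "('d::finite) config" where
  "delta_origin x = (if x = 0 then 1 else 0)"

text \<open>An enumeration of the sites is a bijection \<open>e\<close> from the natural numbers to the lattice;
  sites are compared by their position in it.\<close>

definition smallest_unstable :: "(nat \<Rightarrow> ('d::finite) site) \<Rightarrow> 'd config \<Rightarrow> 'd site" where
  "smallest_unstable e \<eta> = e (LEAST i. unstable \<eta> (e i))"

definition step :: "(nat \<Rightarrow> ('d::finite) site) \<Rightarrow> 'd config \<Rightarrow> 'd config" where
  "step e \<eta> = (if \<exists>x. unstable \<eta> x then topple (smallest_unstable e \<eta>) \<eta> else \<eta>)"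

definition config_at ::
  "(nat \<Rightarrow> ('d::finite) site) \<Rightarrow> 'd config \<Rightarrow> nat \<Rightarrow> nat \<Rightarrow> 'd config" where
  "config_at e \<sigma> n t = (step e ^^ t) (\<lambda>x. \<sigma> x + int n * delta_origin x)"

text \<open>The set \<open>T\<^sub>n\<close>: some unstable site exists at time \<open>t\<close>, and \<open>x\<close> is the one that is toppled.\<close>

definition toppled_sites ::
  "(nat \<Rightarrow> ('d::finite) site) \<Rightarrow> 'd config \<Rightarrow> nat \<Rightarrow> 'd site set" where
  "toppled_sites e \<sigma> n =
     {x. \<exists>t. (\<exists>y. unstable (config_at e \<sigma> n t) y) \<and> x = smallest_unstable e (config_at e \<sigma> n t)}"

definition explosive :: "(nat \<Rightarrow> ('d::finite) site) \<Rightarrow> 'd config \<Rightarrow> bool" where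
  "explosive e \<sigma> \<longleftrightarrow> (\<exists>n\<ge>1. toppled_sites e \<sigma> n = UNIV)"

definition cube :: "int \<Rightarrow> ('d::finite) site set" where
  "cube r = {x. (MAX i. \<bar>x $ i\<bar>) \<le> r}"

definition outer_face :: "('d::finite) site \<Rightarrow> 'd site set \<Rightarrow> 'd site set" where
  "outer_face \<psi> R = {y. y \<notin> R \<and> y - \<psi> \<in> R}"

lemma card_directions: "card (directions :: ('d::finite) site set) = 2 * CARD('d)"
proof -
  have inj: "inj (\<lambda>k::'d. axis k (1::int))" "inj (\<lambda>k::'d. axis k (-1::int))"
    by (auto simp: inj_on_def axis_eq_axis)
  have "range (\<lambda>k::'d. axis k (1::int)) \<inter> range (\<lambda>k::'d. axis k (-1::int)) = {}"
    by (auto simp: axis_eq_axis)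
  then show ?thesis
    unfolding directions_def by (simp add: card_Un_disjoint card_image inj)
qed

lemma enumeration_exists: "\<exists>e :: nat \<Rightarrow> ('d::finite) site. bij e"
proof -
  have "infinite (UNIV :: ('d site) set)"
    by (rule infinite_UNIV_vec) (rule infinite_UNIV_int)
  then show ?thesis
    using bij_betw_from_nat_into[of "UNIV :: ('d site) set"] by auto
qed

end

theory Submission
  imports Defs
begin

text \<open>An unstable site stays unstable until it topples, and finitely many sites cannot carry all
  topplings from some time on, so every unstable site topples eventually. Hence a site that receives
  enough particles from its neighbours to become unstable belongs to \<open>T\<^sub>n\<close>. For large \<open>n\<close> the
  origin topples many times, and by induction along paths every site of \<open>Q\<^bsub>r\<^sub>0\<^esub>\<close> topples.
  If \<open>T\<^sub>n\<close> contains a prism, each site of an outer face receives a particle from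
  it; a site of the face with at least \<open>2d - 1\<close> particles then topples, and the remaining sites of
  the face follow, since each also receives a particle from a neighbour within the face. Adding
  faces in all \<open>2d\<close> directions passes from \<open>Q\<^sub>r\<close> to \<open>Q\<^bsub>r+1\<^esub>\<close>.\<close>

section \<open>Counting topplings: the odometer and the particle balance\<close>

definition fires ::
  "(nat \<Rightarrow> ('d::finite) site) \<Rightarrow> 'd config \<Rightarrow> nat \<Rightarrow> nat \<Rightarrow> 'd site \<Rightarrow> bool" where
  "fires e \<sigma> n t x \<longleftrightarrow>
     (\<exists>y. unstable (config_at e \<sigma> n t) y) \<and> x = smallest_unstable e (config_at e \<sigma> n t)"

text \<open>Only topplings strictly before time \<open>t\<close> count, because
  \<open>config_at\<close> at \<open>t\<close> is the state just before the toppling at time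
  \<open>t\<close>.\<close>

definition odometer ::
  "(nat \<Rightarrow> ('d::finite) site) \<Rightarrow> 'd config \<Rightarrow> nat \<Rightarrow> nat \<Rightarrow> 'd site \<Rightarrow> nat" where
  "odometer e \<sigma> n t x = card {s. s < t \<and> fires e \<sigma> n s x}"

lemma odometer_0 [simp]: "odometer e \<sigma> n 0 x = 0"
  by (simp add: odometer_def)

lemma odometer_Suc:
  "odometer e \<sigma> n (Suc t) x = odometer e \<sigma> n t x + (if fires e \<sigma> n t x then 1 else 0)"
proof -
  have "{s. s < Suc t \<and> fires e \<sigma> n s x} =
      {s. s < t \<and> fires e \<sigma> n s x} \<union> (if fires e \<sigma> n t x then {t} else {})"
    by (auto simp: less_Suc_eq)
  then show ?thesis
    by (simp add: odometer_def)
qed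

lemma odometer_mono: "s \<le> t \<Longrightarrow> odometer e \<sigma> n s x \<le> odometer e \<sigma> n t x"
  unfolding odometer_def by (rule card_mono) auto

lemma toppled_sites_odometer: "x \<in> toppled_sites e \<sigma> n \<longleftrightarrow> (\<exists>t. odometer e \<sigma> n t x \<ge> 1)"
proof
  assume "x \<in> toppled_sites e \<sigma> n"
  then obtain t where "fires e \<sigma> n t x"
    by (auto simp: toppled_sites_def fires_def)
  then have "odometer e \<sigma> n (Suc t) x \<ge> 1"
    by (simp add: odometer_Suc)
  then show "\<exists>t. odometer e \<sigma> n t x \<ge> 1" ..
next
  assume "\<exists>t. odometer e \<sigma> n t x \<ge> 1"
  then obtain t where "{s. s < t \<and> fires e \<sigma> n s x} \<noteq> {}"
    by (metis card.empty not_one_le_zero odometer_def)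
  then show "x \<in> toppled_sites e \<sigma> n"
    by (auto simp: toppled_sites_def fires_def)
qed

lemma config_at_Suc:
  "config_at e \<sigma> n (Suc t) y = config_at e \<sigma> n t y
     - (if fires e \<sigma> n t y then 2 * int CARD('d) else 0)
     + (if \<exists>x. fires e \<sigma> n t x \<and> y - x \<in> directions then 1 else 0)"
  for y :: "('d::finite) site"
  by (auto simp: config_at_def step_def topple_def fires_def)

lemma fires_unique: "fires e \<sigma> n t x \<Longrightarrow> fires e \<sigma> n t y \<Longrightarrow> x = y"
  by (simp add: fires_def)

lemma finite_directions [simp]: "finite (directions :: ('d::finite) site set)"
  by (simp add: directions_def)

lemma sum_directions:
  fixes f :: "('d::finite) site \<Rightarrow> 'a::comm_monoid_add"
  shows "sum f directions = (\<Sum>k\<in>UNIV. f (axis k 1)) + (\<Sum>k\<in>UNIV. f (axis k (-1)))"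
proof -
  have inj: "inj (\<lambda>k::'d. axis k (1::int))" "inj (\<lambda>k::'d. axis k (-1::int))"
    by (auto simp: inj_on_def axis_eq_axis)
  have "range (\<lambda>k::'d. axis k (1::int)) \<inter> range (\<lambda>k::'d. axis k (-1::int)) = {}"
    by (auto simp: axis_eq_axis)
  then show ?thesis
    unfolding directions_def by (simp add: sum.union_disjoint sum.reindex[OF inj(1)] sum.reindex[OF inj(2)])
qed

text \<open>At most one site fires at each time, so at most one direction contributes to the
  sum.\<close>

lemma sum_directions_count:
  "(\<Sum>\<psi>\<in>directions. if fires e \<sigma> n t (x - \<psi>) then 1 else 0) =
     (if \<exists>y. fires e \<sigma> n t y \<and> x - y \<in> directions then 1 else (0::nat))"
proof (cases "\<exists>y. fires e \<sigma> n t y \<and> x - y \<in> directions")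
  case True
  then obtain y where y: "fires e \<sigma> n t y" "x - y \<in> directions" by blast
  then have "fires e \<sigma> n t (x - \<psi>) \<longleftrightarrow> \<psi> = x - y" for \<psi>
    using fires_unique[OF y(1)] by (metis add_diff_cancel_left' diff_add_cancel)
  with y True show ?thesis by simp
next
  case False
  then have "\<not> fires e \<sigma> n t (x - \<psi>)" if "\<psi> \<in> directions" for \<psi>
    using that by force
  with False show ?thesis by simp
qed

text \<open>Conservation of particles: each toppling of \<open>x\<close> sends out \<open>2d\<close>
  of them, each toppling of a neighbour brings in one. The odometer terms together are the discrete
  Laplacian of the odometer.\<close>

lemma config_at_odometer:
  "config_at e \<sigma> n t x = \<sigma> x + int n * delta_origin x
     - 2 * int CARD('d) * int (odometer e \<sigma> n t x)
     + int (\<Sum>\<psi>\<in>directions. odometer e \<sigma> n t (x - \<psi>))"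
  for x :: "('d::finite) site"
proof (induction t)
  case 0
  then show ?case by (simp add: config_at_def)
next
  case (Suc t)
  have "(\<Sum>\<psi>\<in>directions. odometer e \<sigma> n (Suc t) (x - \<psi>)) =
      (\<Sum>\<psi>\<in>directions. odometer e \<sigma> n t (x - \<psi>)) +
      (if \<exists>y. fires e \<sigma> n t y \<and> x - y \<in> directions then 1 else 0)"
    by (simp only: odometer_Suc sum.distrib sum_directions_count)
  then show ?case
    by (simp add: config_at_Suc Suc.IH odometer_Suc[of e \<sigma> n t x] algebra_simps)
qed

section \<open>Every unstable site topples eventually\<close>

text \<open>As long as \<open>e k\<close> is unstable, this confines topplings to the first
  \<open>k + 1\<close> sites of the enumeration.\<close>

lemma fires_smallest:
  assumes x: "unstable (config_at e \<sigma> n t) (e k)"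
  shows "\<exists>j\<le>k. fires e \<sigma> n t (e j) \<and> unstable (config_at e \<sigma> n t) (e j)"
  using x unfolding fires_def smallest_unstable_def
  by (metis (mono_tags, lifting) LeastI Least_le)

lemma fires_unstable:
  assumes "bij e" and "fires e \<sigma> n t x"
  shows "unstable (config_at e \<sigma> n t) x"
proof -
  obtain k where "unstable (config_at e \<sigma> n t) (e k)"
    using assms by (metis fires_def bij_pointE)
  then show ?thesis
    using fires_smallest fires_unique[OF assms(2)] by blast
qed

text \<open>The weight \<open>C - x\<^sub>k\<^sup>2\<close> has constant negative Laplacian, so each toppling lowers the
  weighted mass. Restricting to a finite set on whose neighbourhood the weight is nonnegative only
  discards nonnegative terms.\<close>

lemma sum_directions_square:
  fixes x :: "('d::finite) site"
  shows "(\<Sum>\<psi>\<in>directions. C - ((x + \<psi>) $ k)\<^sup>2) = 2 * int CARD('d) * (C - (x $ k)\<^sup>2) - 2"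
proof -
  have "(\<Sum>j\<in>UNIV. C - ((x + axis j c) $ k)\<^sup>2) =
      int CARD('d) * (C - (x $ k)\<^sup>2) - (2 * c * x $ k + c\<^sup>2)" for c
  proof -
    have "C - ((x + axis j c) $ k)\<^sup>2 =
        (C - (x $ k)\<^sup>2) - (if j = k then 2 * c * x $ k + c\<^sup>2 else 0)" for j
      by (simp add: axis_def power2_sum)
    then have "(\<Sum>j\<in>UNIV. C - ((x + axis j c) $ k)\<^sup>2) =
        (\<Sum>j\<in>(UNIV :: 'd set). (C - (x $ k)\<^sup>2) - (if j = k then 2 * c * x $ k + c\<^sup>2 else 0))"
      by (rule sum.cong[OF refl])
    also have "\<dots> = (\<Sum>j\<in>(UNIV :: 'd set). C - (x $ k)\<^sup>2)
        - (\<Sum>j\<in>UNIV. if j = k then 2 * c * x $ k + c\<^sup>2 else 0)"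
      by (rule sum_subtractf)
    finally show ?thesis by (simp del: sum_subtractf)
  qed
  \<comment> \<open>Adding the cases \<open>c = 1\<close> and \<open>c = -1\<close> cancels the
    linear terms and leaves the constant 2.\<close>
  then show ?thesis
    by (simp add: sum_directions del: vector_add_component)
qed

lemma weighted_sum_decreases:
  fixes S :: "('d::finite) site set"
  assumes S: "finite S" and x: "x \<in> S" "fires e \<sigma> n t x"
    and w: "w = (\<lambda>y. C - (y $ k)\<^sup>2)" and nonneg: "\<And>\<psi>. \<psi> \<in> directions \<Longrightarrow> w (x + \<psi>) \<ge> 0"
  shows "(\<Sum>y\<in>S. w y * config_at e \<sigma> n (Suc t) y) \<le> (\<Sum>y\<in>S. w y * config_at e \<sigma> n t y) - 2"
proof -
  have fx: "fires e \<sigma> n t y \<longleftrightarrow> y = x" for y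
    using x fires_unique by blast
  have "(\<Sum>y\<in>S. w y * config_at e \<sigma> n (Suc t) y) =
     (\<Sum>y\<in>S. w y * config_at e \<sigma> n t y - (if y = x then 2 * int CARD('d) * w y else 0)
        + (if y - x \<in> directions then w y else 0))"
    by (intro sum.cong) (auto simp: config_at_Suc fx algebra_simps)
  also have "\<dots> = (\<Sum>y\<in>S. w y * config_at e \<sigma> n t y) - 2 * int CARD('d) * w x
      + (\<Sum>y\<in>S. if y - x \<in> directions then w y else 0)"
    using S x by (simp add: sum.distrib sum_subtractf)
  also have "(\<Sum>y\<in>S. if y - x \<in> directions then w y else 0) =
      (\<Sum>y\<in>{y\<in>S. y - x \<in> directions}. w y)"
    using S by (simp add: sum.inter_filter)
  also have "\<dots> \<le> (\<Sum>y\<in>(+) x ` directions. w y)"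
  proof (rule sum_mono2)
    show "{y \<in> S. y - x \<in> directions} \<subseteq> (+) x ` directions"
      by (auto intro!: image_eqI[where x = "y - x" for y])
  qed (use nonneg in auto)
  also have "\<dots> = (\<Sum>\<psi>\<in>directions. w (x + \<psi>))"
    by (simp add: sum.reindex)
  also have "\<dots> = 2 * int CARD('d) * w x - 2"
    unfolding w by (rule sum_directions_square)
  finally show ?thesis by simp
qed

text \<open>Particles are lost only by toppling, and a site that topples holds at least
  \<open>2d\<close>, so it is left nonnegative.\<close>

lemma config_at_lower:
  assumes e: "bij e" and "s \<le> t"
  shows "config_at e \<sigma> n t y \<ge> min (config_at e \<sigma> n s y) 0"
  using \<open>s \<le> t\<close>
proof (induction t rule: dec_induct)
  case base
  then show ?case by simp
next
  case (step t)
  then show ?case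
    using fires_unstable[OF e, of \<sigma> n t y]
    by (auto simp: config_at_Suc unstable_def)
qed

text \<open>Otherwise \<open>x\<close> stays unstable and every later toppling happens in the finite
  set of sites enumerated no later than \<open>x\<close>. Their weighted mass would then drop by at
  least 2 at each step, although it is bounded below.\<close>

lemma unstable_fires_later:
  fixes e :: "nat \<Rightarrow> ('d::finite) site"
  assumes e: "bij e" and unst: "unstable (config_at e \<sigma> n t) x"
  shows "\<exists>s\<ge>t. fires e \<sigma> n s x"
proof (rule ccontr)
  assume "\<not> ?thesis"
  then have never: "\<not> fires e \<sigma> n s x" if "s \<ge> t" for s
    using that by blast
  have unst': "unstable (config_at e \<sigma> n s) x" if "s \<ge> t" for s
    using that
  proof (induction s rule: dec_induct)
    case base
    show ?case by (fact unst)
  next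
    case (step s)
    then show ?case
      using never[of s] by (auto simp: config_at_Suc unstable_def)
  qed
  obtain m where m: "e m = x"
    using e by (metis bij_pointE)
  define S where "S = e ` {..m}"
  have S: "finite S" by (simp add: S_def)
  have fire: "\<exists>y\<in>S. fires e \<sigma> n s y" if "s \<ge> t" for s
    using fires_smallest[of e \<sigma> n s m] unst'[OF that] by (auto simp: S_def m)
  obtain k :: 'd where True by blast
  \<comment> \<open>\<open>D\<close> adds to \<open>S\<close> all its neighbours, where the weight
    must also be nonnegative; taking \<open>C\<close> as the sum of all squares over
    \<open>D\<close> ensures this.\<close>
  define D where "D = S \<union> (\<Union>\<psi>\<in>directions. (\<lambda>y. y + \<psi>) ` S)"
  have D: "finite D" using S by (simp add: D_def)
  define C where "C = (\<Sum>y\<in>D. (y $ k)\<^sup>2)"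
  define w where "w = (\<lambda>y :: 'd site. C - (y $ k)\<^sup>2)"
  have w: "w y \<ge> 0" if "y \<in> D" for y
    using member_le_sum[OF that, of "\<lambda>y. (y $ k)\<^sup>2"] D by (simp add: w_def C_def)
  define \<Phi> where "\<Phi> s = (\<Sum>y\<in>S. w y * config_at e \<sigma> n s y)" for s
  define L where "L = (\<Sum>y\<in>S. w y * min (config_at e \<sigma> n t y) 0)"
  have lower: "\<Phi> s \<ge> L" if "s \<ge> t" for s
    unfolding \<Phi>_def L_def
    by (intro sum_mono mult_left_mono config_at_lower[OF e that] w) (simp add: D_def)
  have decr: "\<Phi> (t + j) \<le> \<Phi> t - 2 * int j" for j
  proof (induction j)
    case 0
    show ?case by simp
  next
    case (Suc j)
    obtain y where y: "y \<in> S" "fires e \<sigma> n (t + j) y"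
      using fire[of "t + j"] by auto
    have "\<Phi> (Suc (t + j)) \<le> \<Phi> (t + j) - 2"
      unfolding \<Phi>_def
      by (rule weighted_sum_decreases[OF S y w_def]) (use y in \<open>force intro: w simp: D_def\<close>)
    with Suc show ?case by simp
  qed
  \<comment> \<open>After this many steps the mass lies below \<open>L\<close>; since
    \<open>L \<le> \<Phi> t\<close>, the conversion by \<open>nat\<close> truncates nothing.\<close>
  have "L \<le> \<Phi> t - 2 * int (nat (\<Phi> t - L + 1))"
    using lower[of "t + nat (\<Phi> t - L + 1)"] decr[of "nat (\<Phi> t - L + 1)"] by simp
  with lower[of t] show False by linarith
qed

section \<open>Received particles force topplings\<close>

lemma delta_origin_nonneg: "int n * delta_origin x \<ge> 0"
  by (simp add: delta_origin_def)

text \<open>A site that has toppled exactly \<open>m\<close> times, with initial and received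
  particles amounting to at least \<open>2d(m + 1)\<close>, still holds at least \<open>2d\<close>
  and must topple again.\<close>

lemma odometer_reaches:
  fixes e :: "nat \<Rightarrow> ('d::finite) site"
  assumes e: "bij e"
    and mass: "\<sigma> x + int n * delta_origin x + int (\<Sum>\<psi>\<in>directions. odometer e \<sigma> n t (x - \<psi>))
      \<ge> 2 * int CARD('d) * int m"
  shows "\<exists>s. odometer e \<sigma> n s x \<ge> m"
  using mass
proof (induction m)
  case 0
  show ?case by simp
next
  case (Suc m)
  have "2 * int CARD('d) * int m \<le> 2 * int CARD('d) * int (Suc m)"
    by (intro mult_left_mono) auto
  then obtain s where s: "odometer e \<sigma> n s x \<ge> m"
    using Suc by fastforce
  \<comment> \<open>At the later of the two times both facts hold, since odometers never
    decrease.\<close>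
  define u where "u = max s t"
  have u: "odometer e \<sigma> n u x \<ge> m"
    using odometer_mono[of s u e \<sigma> n x] s by (simp add: u_def)
  show ?case
  proof (cases "odometer e \<sigma> n u x \<ge> Suc m")
    case False
    with u have "odometer e \<sigma> n u x = m" by simp
    moreover have "(\<Sum>\<psi>\<in>directions. odometer e \<sigma> n t (x - \<psi>))
        \<le> (\<Sum>\<psi>\<in>directions. odometer e \<sigma> n u (x - \<psi>))"
      by (intro sum_mono odometer_mono) (simp add: u_def)
    then have "int (\<Sum>\<psi>\<in>directions. odometer e \<sigma> n t (x - \<psi>))
        \<le> int (\<Sum>\<psi>\<in>directions. odometer e \<sigma> n u (x - \<psi>))"
      by (subst of_nat_le_iff)
    ultimately have "unstable (config_at e \<sigma> n u) x"
      using Suc.prems by (simp add: unstable_def config_at_odometer algebra_simps del: of_nat_sum)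
    then obtain v where v: "v \<ge> u" "fires e \<sigma> n v x"
      using unstable_fires_later[OF e] by blast
    then have "odometer e \<sigma> n (Suc v) x \<ge> Suc m"
      using u odometer_mono[OF v(1), of e \<sigma> n x] by (simp add: odometer_Suc)
    then show ?thesis ..
  qed blast
qed

text \<open>Each toppled neighbour has sent at least one particle by some common time. The filling
  of faces uses the dynamics only through this closure property.\<close>

lemma toppled_sites_closed:
  fixes e :: "nat \<Rightarrow> ('d::finite) site"
  assumes e: "bij e"
    and mass: "\<sigma> x + int (card {\<psi>\<in>directions. x - \<psi> \<in> toppled_sites e \<sigma> n}) \<ge> 2 * int CARD('d)"
  shows "x \<in> toppled_sites e \<sigma> n"
proof -
  let ?N = "{\<psi>\<in>directions. x - \<psi> \<in> toppled_sites e \<sigma> n}"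
  have "\<forall>\<psi>\<in>?N. \<exists>t. odometer e \<sigma> n t (x - \<psi>) \<ge> 1"
    by (auto simp: toppled_sites_odometer)
  then obtain \<tau> where \<tau>: "odometer e \<sigma> n (\<tau> \<psi>) (x - \<psi>) \<ge> 1" if "\<psi> \<in> ?N" for \<psi>
    by metis
  \<comment> \<open>The sum serves as an upper bound for the finitely many times.\<close>
  define t where "t = (\<Sum>\<psi>\<in>?N. \<tau> \<psi>)"
  have "odometer e \<sigma> n t (x - \<psi>) \<ge> 1" if "\<psi> \<in> ?N" for \<psi>
  proof -
    have "\<tau> \<psi> \<le> t"
      unfolding t_def by (rule member_le_sum) (use that in auto)
    then show ?thesis
      using \<tau>[OF that] odometer_mono[of "\<tau> \<psi>" t e \<sigma> n "x - \<psi>"] by linarith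
  qed
  then have "card ?N \<le> (\<Sum>\<psi>\<in>?N. odometer e \<sigma> n t (x - \<psi>))"
    using sum_mono[of ?N "\<lambda>_. 1" "\<lambda>\<psi>. odometer e \<sigma> n t (x - \<psi>)"] by simp
  also have "\<dots> \<le> (\<Sum>\<psi>\<in>directions. odometer e \<sigma> n t (x - \<psi>))"
    by (rule sum_mono2) auto
  finally have "\<sigma> x + int n * delta_origin x + int (\<Sum>\<psi>\<in>directions. odometer e \<sigma> n t (x - \<psi>))
      \<ge> 2 * int CARD('d) * int 1"
    using mass delta_origin_nonneg[of n x] by linarith
  then show ?thesis
    using odometer_reaches[OF e] by (simp add: toppled_sites_odometer)
qed

section \<open>Toppling a given cube by taking \<open>n\<close> large\<close>

lemma lattice_induct [case_names origin neighbour]: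
  fixes x :: "('d::finite) site"
  assumes "P 0" and nb: "\<And>x \<psi>. \<psi> \<in> directions \<Longrightarrow> P (x - \<psi>) \<Longrightarrow> P x"
  shows "P x"
proof (induction "\<Sum>i\<in>UNIV. nat \<bar>x $ i\<bar>" arbitrary: x rule: less_induct)
  case less
  show ?case
  proof (cases "x = 0")
    case True
    with \<open>P 0\<close> show ?thesis by simp
  next
    case False
    then obtain i where i: "x $ i \<noteq> 0" by (auto simp: vec_eq_iff)
    \<comment> \<open>This direction points away from the origin, so \<open>x - \<psi>\<close> has
      smaller l1-norm.\<close>
    define \<psi> where "\<psi> = (axis i (sgn (x $ i)) :: 'd site)"
    have "(\<Sum>j\<in>UNIV. nat \<bar>(x - \<psi>) $ j\<bar>) < (\<Sum>j\<in>UNIV. nat \<bar>x $ j\<bar>)"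
    proof (rule sum_strict_mono_ex1)
      show "\<forall>j\<in>UNIV. nat \<bar>(x - \<psi>) $ j\<bar> \<le> nat \<bar>x $ j\<bar>"
        by (auto simp: \<psi>_def axis_def sgn_if)
      show "\<exists>j\<in>UNIV. nat \<bar>(x - \<psi>) $ j\<bar> < nat \<bar>x $ j\<bar>"
        by (rule bexI[of _ i]) (use i in \<open>auto simp: \<psi>_def axis_def sgn_if\<close>)
    qed simp
    moreover have "\<psi> \<in> directions"
      using i by (auto simp: \<psi>_def directions_def sgn_if)
    ultimately show ?thesis
      using less nb by blast
  qed
qed

lemma odometer_unbounded:
  fixes e :: "nat \<Rightarrow> ('d::finite) site"
  assumes e: "bij e" and lower: "\<forall>x. \<sigma> x \<ge> 2 * int CARD('d) - 2"
  shows "\<exists>n0. \<forall>n\<ge>n0. \<exists>t. odometer e \<sigma> n t x \<ge> m"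
proof (induction x arbitrary: m rule: lattice_induct)
  case origin
  have pos: "\<sigma> 0 \<ge> 0"
    using lower[rule_format, of 0] zero_less_card_finite[where 'a = 'd] by linarith
  have "\<exists>t. odometer e \<sigma> n t 0 \<ge> m" if "n \<ge> 2 * CARD('d) * m" for n
  proof (rule odometer_reaches[OF e, where t = 0])
    have "int (2 * CARD('d) * m) \<le> int n" using that by (subst of_nat_le_iff)
    then show "2 * int CARD('d) * int m \<le> \<sigma> 0 + int n * delta_origin (0 :: 'd site) +
        int (\<Sum>\<psi>\<in>directions. odometer e \<sigma> n 0 (0 - \<psi>))"
      using pos by (simp add: delta_origin_def)
  qed
  then show ?case by blast
next
  case (neighbour x \<psi>)
  obtain n0 where n0: "\<forall>n\<ge>n0. \<exists>t. odometer e \<sigma> n t (x - \<psi>) \<ge> 2 * CARD('d) * m"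
    using neighbour by blast
  have pos: "\<sigma> x \<ge> 0"
    using lower[rule_format, of x] zero_less_card_finite[where 'a = 'd] by linarith
  have "\<exists>t. odometer e \<sigma> n t x \<ge> m" if "n \<ge> n0" for n
  proof -
    obtain t where t: "odometer e \<sigma> n t (x - \<psi>) \<ge> 2 * CARD('d) * m"
      using n0 \<open>n \<ge> n0\<close> by blast
    have "odometer e \<sigma> n t (x - \<psi>) \<le> (\<Sum>\<psi>\<in>directions. odometer e \<sigma> n t (x - \<psi>))"
      by (rule member_le_sum) (use neighbour in auto)
    with t have "int (2 * CARD('d) * m) \<le> int (\<Sum>\<psi>\<in>directions. odometer e \<sigma> n t (x - \<psi>))"
      by (subst of_nat_le_iff) linarith
    then show ?thesis
      using pos delta_origin_nonneg[of n x]
      by (intro odometer_reaches[OF e, where t = t]) (simp del: of_nat_sum)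
  qed
  then show ?case by blast
qed

lemma mem_cube: "x \<in> cube r \<longleftrightarrow> (\<forall>i. \<bar>x $ i\<bar> \<le> r)"
  by (simp add: cube_def)

lemma finite_cube: "finite (cube r :: ('d::finite) site set)"
proof (rule finite_imageD)
  show "inj_on vec_nth (cube r :: 'd site set)"
    by (simp add: inj_on_def vec_nth_inject)
  have "vec_nth ` (cube r :: 'd site set) \<subseteq> {f. \<forall>i. (i \<in> UNIV \<longrightarrow> f i \<in> {- r..r}) \<and> (i \<notin> UNIV \<longrightarrow> f i = 0)}"
    by (auto simp: mem_cube abs_le_iff minus_le_iff)
  then show "finite (vec_nth ` (cube r :: 'd site set))"
    by (rule finite_subset) (intro finite_set_of_finite_funs; simp)
qed

lemma cube_toppled:
  fixes e :: "nat \<Rightarrow> ('d::finite) site"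
  assumes e: "bij e" and lower: "\<forall>x. \<sigma> x \<ge> 2 * int CARD('d) - 2"
  shows "\<exists>n\<ge>1. cube r \<subseteq> toppled_sites e \<sigma> n"
proof -
  obtain N where N: "\<And>x n. n \<ge> N x \<Longrightarrow> \<exists>t. odometer e \<sigma> n t x \<ge> 1"
    using odometer_unbounded[OF assms] by metis
  \<comment> \<open>The sum exceeds or equals every threshold \<open>N x\<close> in the cube, and
    \<open>Suc\<close> makes \<open>n\<close> positive.\<close>
  define n where "n = Suc (\<Sum>x\<in>cube r. N x)"
  have "x \<in> toppled_sites e \<sigma> n" if "x \<in> cube r" for x
    using member_le_sum[OF that, of N] finite_cube[where 'd = 'd] N[of x n]
    by (simp add: toppled_sites_odometer n_def)
  then show ?thesis by (intro exI[of _ n]) (auto simp: n_def)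
qed

section \<open>Filling the outer faces of prisms\<close>

text \<open>Independent bounds for each side allow a cube to be enlarged one face at a time.\<close>

definition prism :: "('d \<Rightarrow> int) \<Rightarrow> ('d \<Rightarrow> int) \<Rightarrow> ('d::finite) site set" where
  "prism a b = {x. \<forall>i. a i \<le> x $ i \<and> x $ i \<le> b i}"

lemma directionsE:
  assumes "\<psi> \<in> directions"
  obtains k c where "\<psi> = axis k c" "c = 1 \<or> c = -1"
  using assms by (auto simp: directions_def)

text \<open>Only coordinate \<open>k\<close> can leave its interval under a step along
  \<open>\<psi>\<close>, so it sits exactly one past an end. The conjunct
  \<open>a k \<le> b k\<close> excludes an empty interval.\<close>

lemma outer_face_prism:
  assumes "\<psi> = axis k c" "c = 1 \<or> c = -1"
  shows "y \<in> outer_face \<psi> (prism a b) \<longleftrightarrow>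
    (\<forall>i. i \<noteq> k \<longrightarrow> a i \<le> y $ i \<and> y $ i \<le> b i) \<and> a k \<le> b k \<and>
    y $ k = (if c = 1 then b k + 1 else a k - 1)"
proof -
  have "y \<in> prism a b \<longleftrightarrow>
      (\<forall>i. i \<noteq> k \<longrightarrow> a i \<le> y $ i \<and> y $ i \<le> b i) \<and> a k \<le> y $ k \<and> y $ k \<le> b k"
    by (auto simp: prism_def)
  moreover have "y - \<psi> \<in> prism a b \<longleftrightarrow>
      (\<forall>i. i \<noteq> k \<longrightarrow> a i \<le> y $ i \<and> y $ i \<le> b i) \<and> a k \<le> y $ k - c \<and> y $ k - c \<le> b k"
    unfolding prism_def assms(1) axis_def by (simp split: if_splits) blast
  ultimately show ?thesis
    using assms(2) by (auto simp: outer_face_def)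
qed

text \<open>Induction on the l1-distance to the seed \<open>z\<close>, which needs only the particle
  from the prism. Any other site gets one from the prism and one from a face neighbour nearer to
  \<open>z\<close>.\<close>

lemma outer_face_filled:
  fixes \<sigma> :: "('d::finite) config"
  assumes closed: "\<And>x. \<sigma> x + int (card {\<psi>\<in>directions. x - \<psi> \<in> T}) \<ge> 2 * int CARD('d) \<Longrightarrow> x \<in> T"
    and lower: "\<forall>x. \<sigma> x \<ge> 2 * int CARD('d) - 2"
    and R: "prism a b \<subseteq> T" and \<psi>: "\<psi> \<in> directions"
    and z: "z \<in> outer_face \<psi> (prism a b)" "\<sigma> z \<ge> 2 * int CARD('d) - 1"
  shows "outer_face \<psi> (prism a b) \<subseteq> T"
proof
  fix y assume "y \<in> outer_face \<psi> (prism a b)"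
  then show "y \<in> T"
  proof (induction "\<Sum>i\<in>UNIV. nat \<bar>y $ i - z $ i\<bar>" arbitrary: y rule: less_induct)
    case less
    have nb: "y - \<psi> \<in> T"
      using less.prems R by (auto simp: outer_face_def)
    show ?case
    proof (cases "y = z")
      case True
      have "card {\<psi>} \<le> card {\<psi>\<in>directions. y - \<psi> \<in> T}"
        by (rule card_mono) (use nb \<psi> in auto)
      then show ?thesis
        using z True by (intro closed) simp
    next
      case False
      then obtain i where i: "y $ i \<noteq> z $ i" by (auto simp: vec_eq_iff)
      obtain k c where \<psi>k: "\<psi> = axis k c" "c = 1 \<or> c = -1"
        using directionsE[OF \<psi>] by blast
      note face = outer_face_prism[OF \<psi>k]
      have "i \<noteq> k"
        using i less.prems z(1) face by auto
      \<comment> \<open>Stepping back along \<open>\<phi>\<close> moves coordinate \<open>i\<close>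
        of \<open>y\<close> towards that of \<open>z\<close>, hence stays in the face;
        \<open>i \<noteq> k\<close> makes this a second source of particles besides
        \<open>\<psi>\<close>.\<close>
      define \<phi> where "\<phi> = (axis i (sgn (y $ i - z $ i)) :: 'd site)"
      have \<phi>: "\<phi> \<in> directions"
        using i by (auto simp: \<phi>_def directions_def sgn_if)
      have "\<phi> \<noteq> \<psi>"
        using \<open>i \<noteq> k\<close> \<psi>k i by (auto simp: \<phi>_def axis_eq_axis sgn_if)
      have "(\<Sum>j\<in>UNIV. nat \<bar>(y - \<phi>) $ j - z $ j\<bar>) < (\<Sum>j\<in>UNIV. nat \<bar>y $ j - z $ j\<bar>)"
      proof (rule sum_strict_mono_ex1)
        show "\<forall>j\<in>UNIV. nat \<bar>(y - \<phi>) $ j - z $ j\<bar> \<le> nat \<bar>y $ j - z $ j\<bar>"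
          by (auto simp: \<phi>_def axis_def sgn_if)
        show "\<exists>j\<in>UNIV. nat \<bar>(y - \<phi>) $ j - z $ j\<bar> < nat \<bar>y $ j - z $ j\<bar>"
          by (rule bexI[of _ i]) (use i in \<open>auto simp: \<phi>_def axis_def sgn_if\<close>)
      qed simp
      moreover have "y - \<phi> \<in> outer_face \<psi> (prism a b)"
      proof -
        have "a j \<le> (y - \<phi>) $ j \<and> (y - \<phi>) $ j \<le> b j" if "j \<noteq> k" for j
        proof -
          have "a j \<le> y $ j \<and> y $ j \<le> b j" "a j \<le> z $ j \<and> z $ j \<le> b j"
            using less.prems z(1) that unfolding face by blast+
          then show ?thesis by (auto simp: \<phi>_def axis_def sgn_if)
        qed
        moreover have "(y - \<phi>) $ k = y $ k"
          using \<open>i \<noteq> k\<close> by (simp add: \<phi>_def axis_def)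
        ultimately show ?thesis
          using less.prems unfolding face by simp
      qed
      ultimately have "y - \<phi> \<in> T"
        by (rule less.hyps)
      then have "card {\<psi>, \<phi>} \<le> card {\<psi>\<in>directions. y - \<psi> \<in> T}"
        by (intro card_mono) (use nb \<psi> \<phi> in auto)
      then show ?thesis
        using lower[rule_format, of y] \<open>\<phi> \<noteq> \<psi>\<close> by (intro closed) simp
    qed
  qed
qed

text \<open>Each face is taken of the prism already enlarged, so edges and corners of the next cube
  are covered as well.\<close>

lemma cube_step:
  fixes \<sigma> :: "('d::finite) config"
  assumes closed: "\<And>x. \<sigma> x + int (card {\<psi>\<in>directions. x - \<psi> \<in> T}) \<ge> 2 * int CARD('d) \<Longrightarrow> x \<in> T"
    and lower: "\<forall>x. \<sigma> x \<ge> 2 * int CARD('d) - 2"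
    and faces: "\<forall>\<psi>\<in>directions. \<exists>x\<in>outer_face \<psi> (cube r). \<sigma> x \<ge> 2 * int CARD('d) - 1"
    and r: "cube r \<subseteq> T" "r \<ge> 0"
  shows "cube (r + 1) \<subseteq> T"
proof -
  define a where "a A k = - r - (if axis k (-1) \<in> A then 1 else 0)" for A :: "'d site set" and k
  define b where "b A k = r + (if axis k 1 \<in> A then 1 else 0)" for A :: "'d site set" and k
  have cube_prism: "cube r = prism (\<lambda>k::'d. - r) (\<lambda>k. r)" for r
    by (auto simp: mem_cube prism_def abs_le_iff minus_le_iff)
  have "prism (a A) (b A) \<subseteq> T" if "finite A" "A \<subseteq> directions" for A
    using that
  proof (induction A rule: finite_induct)
    case empty
    then show ?case using r by (simp add: a_def b_def cube_prism)
  next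
    case (insert \<psi> A)
    then have \<psi>: "\<psi> \<in> directions" and IH: "prism (a A) (b A) \<subseteq> T" by auto
    obtain k c where \<psi>k: "\<psi> = axis k c" "c = 1 \<or> c = -1"
      using directionsE[OF \<psi>] by blast
    note face = outer_face_prism[OF \<psi>k]
    obtain z where z: "z \<in> outer_face \<psi> (cube r)" "\<sigma> z \<ge> 2 * int CARD('d) - 1"
      using faces \<psi> by blast
    have "a A i \<le> - r" "b A i \<ge> r" for i
      by (auto simp: a_def b_def)
    \<comment> \<open>As \<open>\<psi>\<close> is not yet in \<open>A\<close>, the side facing
      \<open>\<psi>\<close> is where it was in the cube. The cube's face therefore lies in the
      prism's face, and its seed \<open>z\<close> can be reused.\<close>
    moreover have "if c = 1 then b A k = r else a A k = - r"
      using insert(2) \<psi>k by (auto simp: a_def b_def)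
    ultimately have "z \<in> outer_face \<psi> (prism (a A) (b A))"
      using z(1) r(2) unfolding cube_prism face by (smt (verit))
    then have "outer_face \<psi> (prism (a A) (b A)) \<subseteq> T"
      using outer_face_filled[OF closed lower IH \<psi>] z(2) by blast
    moreover have "prism (a (insert \<psi> A)) (b (insert \<psi> A)) \<subseteq> prism (a A) (b A) \<union> outer_face \<psi> (prism (a A) (b A))"
    proof
      fix x assume x: "x \<in> prism (a (insert \<psi> A)) (b (insert \<psi> A))"
      have ins: "a (insert \<psi> A) i = a A i - (if i = k \<and> c = -1 then 1 else 0)"
        "b (insert \<psi> A) i = b A i + (if i = k \<and> c = 1 then 1 else 0)" for i
        using insert(2) \<psi>k by (auto simp: a_def b_def axis_eq_axis)
      have "a A k \<le> b A k" using r by (simp add: a_def b_def)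
      then show "x \<in> prism (a A) (b A) \<union> outer_face \<psi> (prism (a A) (b A))"
        using x \<psi>k(2) unfolding Un_iff face unfolding prism_def mem_Collect_eq ins by (smt (verit))
    qed
    ultimately show ?case using IH by blast
  qed
  moreover have "axis k 1 \<in> directions" "axis k (-1) \<in> directions" for k :: 'd
    by (simp_all add: directions_def)
  then have "a directions = (\<lambda>k. - (r + 1))" "b directions = (\<lambda>k. r + 1)"
    by (simp_all add: a_def b_def fun_eq_iff)
  then have "prism (a directions) (b directions) = cube (r + 1)"
    by (simp add: cube_prism)
  ultimately show ?thesis
    by (metis finite_directions order_refl)
qed

theorem theorem4p1:
  fixes \<sigma> :: "('d::finite) config"
    and e :: "nat \<Rightarrow> 'd site"
  assumes enum: "bij e"
    and lower: "\<forall>x. \<sigma> x \<ge> 2 * int CARD('d) - 2"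
    and faces: "\<exists>r\<^sub>0::nat. \<forall>r::int. r \<ge> int r\<^sub>0 \<longrightarrow>
      (\<forall>\<psi>\<in>directions. \<exists>x\<in>outer_face \<psi> (cube r). \<sigma> x \<ge> 2 * int CARD('d) - 1)"
  shows "explosive e \<sigma>"
proof -
  obtain r0 :: nat where r0: "\<And>r \<psi>. r \<ge> int r0 \<Longrightarrow> \<psi> \<in> directions \<Longrightarrow>
      \<exists>x\<in>outer_face \<psi> (cube r). \<sigma> x \<ge> 2 * int CARD('d) - 1"
    using faces by blast
  obtain n where n: "n \<ge> 1" "cube (int r0) \<subseteq> toppled_sites e \<sigma> n"
    using cube_toppled[OF enum lower] by blast
  \<comment> \<open>One and the same \<open>n\<close> serves for all cubes.\<close>
  have cubes: "cube (int r0 + int j) \<subseteq> toppled_sites e \<sigma> n" for j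
  proof (induction j)
    case 0
    show ?case using n by simp
  next
    case (Suc j)
    have "cube (int r0 + int j + 1) \<subseteq> toppled_sites e \<sigma> n"
      by (rule cube_step[OF toppled_sites_closed[OF enum] lower])
        (use Suc r0[of "int r0 + int j"] in auto)
    then show ?case by (simp add: algebra_simps)
  qed
  have "x \<in> toppled_sites e \<sigma> n" for x
  proof -
    define j where "j = nat (\<Sum>i\<in>UNIV. \<bar>x $ i\<bar>)"
    have "\<bar>x $ i\<bar> \<le> int r0 + int j" for i
      using member_le_sum[of i UNIV "\<lambda>i. \<bar>x $ i\<bar>"] by (simp add: j_def)
    then show ?thesis
      using cubes[of j] by (auto simp: mem_cube)
  qed
  then show ?thesis
    using n(1) by (auto simp: explosive_def)
qed

end
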